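(* Let $n,k,t\ge 1$ be integers with $2k-t\le n<\frac52(k-t)$. Then every inflation $G$ of $K(n,k,\ge t+1)$ that is connected and has $\alpha(G)=2$ has a non-empty connected dominating matching.
   Context: $K(n,k,\ge s)$ is the graph whose vertices are the $k$-element subsets of $\{1,\dots,n\}$, two distinct subsets being adjacent iff they share at least $s$ elements. An inflation of a graph $H$ is obtained by choosing integers $c_x\ge 0$ for $x\in V(H)$, replacing each $x$ by a clique $C_x$ of order $c_x$, with every vertex of $C_x$ adjacent to every vertex of $C_y$ ($x\neq y$) if $xy\in E(H)$ and no edges between them otherwise. A matching $M$ is connected if for any two edges $e,f\in M$ some endpoint of $e$ is adjacent to some endpoint of $f$; it is dominating if every vertex not covered by $M$ is adjacent to at least one endpoint of each edge of $M$. *)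

theory Defs
  imports Complex_Main "HOL-Library.Ramsey" "HOL-Library.Disjoint_Sets"
begin

text \<open>Simple graphs; an edge is the two-element set of its endpoints, the convention under
  which \<^const>\<open>indep\<close> of \<^theory>\<open>HOL-Library.Ramsey\<close> is stated.\<close>

datatype 'a graph = Graph (verts: "'a set") (edges: "'a set set")

definition adj :: "'a graph \<Rightarrow> 'a \<Rightarrow> 'a \<Rightarrow> bool" where
  "adj G u v \<longleftrightarrow> {u, v} \<in> edges G"

definition connected_graph :: "'a graph \<Rightarrow> bool" where
  "connected_graph G \<longleftrightarrow> verts G \<noteq> {} \<and> (\<forall>u\<in>verts G. \<forall>v\<in>verts G. (adj G)\<^sup>*\<^sup>* u v)"

text \<open>Meaningful for finite graphs only, as \<^const>\<open>Max\<close> is unspecified on infinite sets.\<close>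

definition indep_number :: "'a graph \<Rightarrow> nat" where
  "indep_number G = Max (card ` {S. S \<subseteq> verts G \<and> indep S (edges G)})"

definition matching :: "'a graph \<Rightarrow> 'a set set \<Rightarrow> bool" where
  "matching G M \<longleftrightarrow> M \<subseteq> edges G \<and> (\<forall>e\<in>M. \<forall>f\<in>M. e \<noteq> f \<longrightarrow> e \<inter> f = {})"

definition connected_matching :: "'a graph \<Rightarrow> 'a set set \<Rightarrow> bool" where
  "connected_matching G M \<longleftrightarrow> matching G M \<and>
     (\<forall>e\<in>M. \<forall>f\<in>M. e \<noteq> f \<longrightarrow> (\<exists>u\<in>e. \<exists>v\<in>f. adj G u v))"

definition dominating_matching :: "'a graph \<Rightarrow> 'a set set \<Rightarrow> bool" where
  "dominating_matching G M \<longleftrightarrow> matching G M \<and>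
     (\<forall>v\<in>verts G - \<Union>M. \<forall>e\<in>M. \<exists>u\<in>e. adj G v u)"

text \<open>The graph \<open>K(n, k, \<ge> s)\<close>.\<close>

definition kneser_ge :: "nat \<Rightarrow> nat \<Rightarrow> nat \<Rightarrow> nat set graph" where
  "kneser_ge n k s = Graph (nsets {1..n} k)
     {{A, B} | A B. A \<in> nsets {1..n} k \<and> B \<in> nsets {1..n} k \<and> A \<noteq> B \<and> s \<le> card (A \<inter> B)}"

text \<open>The sizes \<open>c\<^sub>x\<close> are \<open>card (C x)\<close>. The cliques \<open>C x\<close> may consist of elements of any type, so
  that inflations are not tied to one concrete representative of their isomorphism class.\<close>

definition is_inflation :: "'b graph \<Rightarrow> 'a graph \<Rightarrow> bool" where
  "is_inflation G H \<longleftrightarrow> (\<exists>C :: 'a \<Rightarrow> 'b set.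
     (\<forall>x\<in>verts H. finite (C x)) \<and>
     disjoint_family_on C (verts H) \<and>
     verts G = (\<Union>x\<in>verts H. C x) \<and>
     edges G =
       {{u, v} | u v x. x \<in> verts H \<and> u \<in> C x \<and> v \<in> C x \<and> u \<noteq> v} \<union>
       {{u, v} | u v x y. x \<in> verts H \<and> y \<in> verts H \<and> x \<noteq> y \<and> adj H x y \<and> u \<in> C x \<and> v \<in> C y})"

end

theory Submission
  imports Defs
begin

text \<open>If some edge \<open>uv\<close> of \<open>G\<close> has no common non-neighbour, then \<open>{uv}\<close> is the matching. Otherwise,
  a common non-neighbour of an edge is a set meeting both ends in at most \<open>t\<close> points, which by
  counting forces the two ends to share more than \<open>(k + t) / 2\<close> points when \<open>n < 5/2 (k - t)\<close>.
  Two \<open>k\<close>-sets that share that much with a third one share more than \<open>t\<close> points, so adjacency is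
  transitive, and the connected graph \<open>G\<close> is complete, contradicting \<open>\<alpha>(G) = 2\<close>.\<close>

lemma adj_kneser_ge_iff:
  "adj (kneser_ge n k s) A B \<longleftrightarrow>
     A \<in> nsets {1..n} k \<and> B \<in> nsets {1..n} k \<and> A \<noteq> B \<and> s \<le> card (A \<inter> B)"
  unfolding adj_def kneser_ge_def by (auto simp: doubleton_eq_iff Int_commute)

text \<open>Replaces the cliques by a map \<open>f\<close> sending each vertex to its
  \<open>k\<close>-set. Since \<open>s \<le> k\<close>, two vertices of one clique meet the
  threshold as well (\<open>f u \<inter> f v\<close> then has \<open>k\<close> elements), so a
  single inequality describes both kinds of edges.\<close>

lemma inflation_kneser_geE:
  assumes "is_inflation G (kneser_ge n k s)" "s \<le> k"
  obtains f where
    "finite (verts G)"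
    "\<And>u. u \<in> verts G \<Longrightarrow> f u \<in> nsets {1..n} k"
    "\<And>u v. adj G u v \<longleftrightarrow> u \<in> verts G \<and> v \<in> verts G \<and> u \<noteq> v \<and> s \<le> card (f u \<inter> f v)"
proof -
  define N where "N = nsets {1..n} k"
  have vH: "verts (kneser_ge n k s) = N" by (simp add: kneser_ge_def N_def)
  obtain C where C: "\<forall>x\<in>N. finite (C x)" "disjoint_family_on C N" "verts G = (\<Union>x\<in>N. C x)"
    and E: "edges G =
       {{u, v} | u v x. x \<in> N \<and> u \<in> C x \<and> v \<in> C x \<and> u \<noteq> v} \<union>
       {{u, v} | u v x y. x \<in> N \<and> y \<in> N \<and> x \<noteq> y \<and> adj (kneser_ge n k s) x y \<and> u \<in> C x \<and> v \<in> C y}"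
    using assms(1) unfolding is_inflation_def vH by (elim exE conjE) (rule that)
  have "\<exists>x. x \<in> N \<and> u \<in> C x" if "u \<in> verts G" for u
    using that C(3) by blast
  then obtain f where f: "f u \<in> N" "u \<in> C (f u)" if "u \<in> verts G" for u
    by metis
  \<comment> \<open>Disjointness of the cliques makes the chosen \<open>f\<close> the only possible
    one.\<close>
  have class_eq: "f u = x" if "x \<in> N" "u \<in> C x" for u x
  proof -
    have "u \<in> verts G" using that C(3) by blast
    then show ?thesis using f[of u] that C(2) by (auto simp: disjoint_family_on_def)
  qed
  have card_N: "card x = k" if "x \<in> N" for x
    using that by (simp add: N_def nsets_def)
  have adj_iff: "adj G u v \<longleftrightarrow> u \<in> verts G \<and> v \<in> verts G \<and> u \<noteq> v \<and> s \<le> card (f u \<inter> f v)" for u v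
  proof
    assume "adj G u v"
    then consider x a b where "{u, v} = {a, b}" "x \<in> N" "a \<in> C x" "b \<in> C x" "a \<noteq> b"
      | x y a b where "{u, v} = {a, b}" "x \<in> N" "y \<in> N" "x \<noteq> y" "s \<le> card (x \<inter> y)" "a \<in> C x" "b \<in> C y"
      unfolding adj_def[of G] E adj_kneser_ge_iff by blast
    then show "u \<in> verts G \<and> v \<in> verts G \<and> u \<noteq> v \<and> s \<le> card (f u \<inter> f v)"
    proof cases
      case 1
      then have "f a = x" "f b = x" "a \<in> verts G" "b \<in> verts G" using class_eq C(3) by blast+
      then show ?thesis using 1 card_N assms(2) by (auto simp: doubleton_eq_iff)
    next
      case 2
      then have "f a = x" "f b = y" "a \<in> verts G" "b \<in> verts G" using class_eq C(3) by blast+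
      then show ?thesis using 2 by (auto simp: doubleton_eq_iff Int_commute)
    qed
  next
    assume r: "u \<in> verts G \<and> v \<in> verts G \<and> u \<noteq> v \<and> s \<le> card (f u \<inter> f v)"
    show "adj G u v"
    proof (cases "f u = f v")
      case True
      then have "f u \<in> N \<and> u \<in> C (f u) \<and> v \<in> C (f u) \<and> u \<noteq> v" using f r by metis
      then show ?thesis unfolding adj_def[of G] E by blast
    next
      case False
      then have "f u \<in> N \<and> f v \<in> N \<and> f u \<noteq> f v \<and> adj (kneser_ge n k s) (f u) (f v)
          \<and> u \<in> C (f u) \<and> v \<in> C (f v)"
        using f r unfolding adj_kneser_ge_iff N_def by blast
      then show ?thesis unfolding adj_def[of G] E by blast
    qed
  qed
  have "finite (verts G)"
    using C by (simp add: N_def finite_imp_finite_nsets)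
  with f(1) adj_iff show thesis using that unfolding N_def by blast
qed

text \<open>\<open>A \<union> B\<close> has \<open>2 * k - card (A \<inter> B)\<close> points and
  \<open>C\<close> adds at least \<open>k - 2 * t\<close> new ones, all inside a ground set of size
  \<open>n\<close>.\<close>

lemma card_Int_ge_of_small_Int:
  assumes "A \<in> nsets {1..n} k" "B \<in> nsets {1..n} k" "C \<in> nsets {1..n} k"
    and "card (C \<inter> A) \<le> t" "card (C \<inter> B) \<le> t"
  shows "3 * k \<le> n + 2 * t + card (A \<inter> B)"
proof -
  have fin: "finite A" "finite B" "finite C"
    and sub: "A \<union> B \<union> C \<subseteq> {1..n}" and card: "card A = k" "card B = k" "card C = k"
    using assms(1-3) by (auto simp: nsets_def)
  have "card (C \<inter> (A \<union> B)) \<le> card (C \<inter> A) + card (C \<inter> B)"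
    by (simp add: Int_Un_distrib card_Un_le)
  moreover have "card (A \<union> B) + card (A \<inter> B) = 2 * k"
    using card_Un_Int[of A B] fin card by simp
  moreover have "card (A \<union> B \<union> C) + card (C \<inter> (A \<union> B)) = card (A \<union> B) + k"
    using card_Un_Int[of "A \<union> B" C] fin card by (simp add: Int_commute)
  moreover have "card (A \<union> B \<union> C) \<le> n"
    using card_mono[OF _ sub] by simp
  ultimately show ?thesis using assms(4,5) by linarith
qed

text \<open>Inclusion-exclusion inside \<open>B\<close>: the sets \<open>A \<inter> B\<close> and
  \<open>B \<inter> C\<close> both lie in \<open>B\<close>, and their common part lies in
  \<open>A \<inter> C\<close>.\<close>

lemma card_Int_trans:
  assumes "finite A" "finite B" "finite C"
  shows "card (A \<inter> B) + card (B \<inter> C) \<le> card B + card (A \<inter> C)"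
proof -
  have "card (A \<inter> B) + card (B \<inter> C) = card ((A \<inter> B) \<union> (B \<inter> C)) + card ((A \<inter> B) \<inter> (B \<inter> C))"
    using assms by (intro card_Un_Int) auto
  also have "\<dots> \<le> card B + card (A \<inter> C)"
    using assms by (intro add_mono card_mono) auto
  finally show ?thesis .
qed

text \<open>Finiteness guarantees that the maximum is attained, so some independent set has exactly
  two elements.\<close>

lemma nonadjacent_pair_if_indep_number_2:
  assumes "finite (verts G)" "indep_number G = 2"
  obtains u v where "u \<in> verts G" "v \<in> verts G" "u \<noteq> v" "\<not> adj G u v"
proof -
  let ?I = "{S. S \<subseteq> verts G \<and> indep S (edges G)}"
  have "finite ?I" using assms(1) by simp
  moreover have "{} \<in> ?I" by (simp add: indep_def)
  ultimately have "Max (card ` ?I) \<in> card ` ?I"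
    by (intro Max_in) blast+
  then have "2 \<in> card ` ?I"
    using assms(2) by (simp only: indep_number_def)
  then obtain S where S: "S \<subseteq> verts G" "indep S (edges G)" "card S = 2" by force
  then obtain u v where "S = {u, v}" "u \<noteq> v" by (auto simp: card_2_iff)
  with S that show thesis by (auto simp: indep_def adj_def)
qed

theorem theorem3p12:
  fixes n k t :: nat and G :: "'a graph"
  assumes "n \<ge> 1" and "k \<ge> 1" and "t \<ge> 1"
    and "2 * real k - real t \<le> real n"
    and "real n < 5 / 2 * (real k - real t)"
    and "is_inflation G (kneser_ge n k (t + 1))"
    and "connected_graph G"
    and "indep_number G = 2"
  shows "\<exists>M. M \<noteq> {} \<and> connected_matching G M \<and> dominating_matching G M"
proof (rule ccontr)
  assume no_matching: "\<not> ?thesis"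
  \<comment> \<open>Doubling clears the fraction, so that the bound can be moved to the
    naturals.\<close>
  have "real (2 * n + 5 * t) < real (5 * k)" using assms(5) by simp
  then have n_less: "2 * n + 5 * t < 5 * k" by (simp only: of_nat_less_iff)
  then have "t + 1 \<le> k" by linarith
  then obtain f where fin: "finite (verts G)"
    and f: "\<And>u. u \<in> verts G \<Longrightarrow> f u \<in> nsets {1..n} k"
    and adj_iff: "\<And>u v. adj G u v \<longleftrightarrow>
      u \<in> verts G \<and> v \<in> verts G \<and> u \<noteq> v \<and> t + 1 \<le> card (f u \<inter> f v)"
    using inflation_kneser_geE[OF assms(6)] by metis
  have f_fin: "finite (f u)" "card (f u) = k" if "u \<in> verts G" for u
    using f[OF that] by (auto simp: nsets_def)
  have large: "k + t < 2 * card (f u \<inter> f v)" if uv: "adj G u v" for u v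
  proof -
    have "\<exists>w\<in>verts G - {u, v}. \<not> adj G w u \<and> \<not> adj G w v"
    proof (rule ccontr)
      assume "\<not> ?thesis"
      \<comment> \<open>For a single edge the pairwise conditions are vacuous, and the assumed
        absence of \<open>w\<close> is domination.\<close>
      then have "connected_matching G {{u, v}} \<and> dominating_matching G {{u, v}}"
        using uv unfolding connected_matching_def dominating_matching_def matching_def adj_def
        by auto
      then show False using no_matching by blast
    qed
    \<comment> \<open>As \<open>w\<close> differs from \<open>u\<close> and \<open>v\<close>,
      non-adjacency can only come from a small intersection.\<close>
    then obtain w where "w \<in> verts G" "card (f w \<inter> f u) \<le> t" "card (f w \<inter> f v) \<le> t"
      using uv unfolding adj_iff by fastforce
    then have "3 * k \<le> n + 2 * t + card (f u \<inter> f v)"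
      using uv f unfolding adj_iff by (intro card_Int_ge_of_small_Int) auto
    \<comment> \<open>Twice the intersection is at least \<open>6 * k - 2 * n - 4 * t\<close>, which
      exceeds \<open>k + t\<close> precisely when \<open>2 * n + 5 * t < 5 * k\<close>.\<close>
    then show ?thesis using n_less by linarith
  qed
  \<comment> \<open>The invariant bounds the intersection instead of asserting adjacency, so that
    walks returning to \<open>u\<close> are covered.\<close>
  have reach: "v \<in> verts G \<and> t + 1 \<le> card (f u \<inter> f v)" if "(adj G)\<^sup>*\<^sup>* u v" "u \<in> verts G" for u v
    using that
  proof (induction rule: rtranclp_induct)
    case base
    then show ?case using f_fin \<open>t + 1 \<le> k\<close> by simp
  next
    case (step v w)
    then have v: "v \<in> verts G" "t + 1 \<le> card (f u \<inter> f v)" and w: "w \<in> verts G"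
      using adj_iff by blast+
    show ?case
    proof (cases "u = v")
      case True
      then show ?thesis using step.hyps(2) adj_iff by blast
    next
      case False
      \<comment> \<open>With \<open>u\<close> and \<open>v\<close> distinct, the invariant is
        adjacency, and \<open>large\<close> strengthens it from \<open>t + 1\<close> to more than
        half of \<open>k + t\<close>. Two such intersections sum to more than \<open>k + t\<close>,
        which leaves more than \<open>t\<close> points for \<open>f u \<inter> f w\<close>.\<close>
      then have "k + t < 2 * card (f u \<inter> f v)" using large v step.prems adj_iff by blast
      moreover have "k + t < 2 * card (f v \<inter> f w)" using large step.hyps(2) by blast
      moreover have "card (f u \<inter> f v) + card (f v \<inter> f w) \<le> k + card (f u \<inter> f w)"
        using card_Int_trans[of "f u" "f v" "f w"] f_fin v(1) w step.prems by simp
      ultimately show ?thesis using w by linarith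
    qed
  qed
  obtain u v where "u \<in> verts G" "v \<in> verts G" "u \<noteq> v" "\<not> adj G u v"
    using nonadjacent_pair_if_indep_number_2[OF fin assms(8)] .
  \<comment> \<open>By connectedness, \<open>reach\<close> applies to every pair of vertices, so
    distinct vertices are always adjacent.\<close>
  then show False using reach assms(7) adj_iff unfolding connected_graph_def by blast
qed

end
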